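(* Let $F$ be a tract with a fixed involution, let $E=\{1,\dots,n\}$, and let $0\le r_1\le\dots\le r_s\le n$ be integers. The association $(M_1,\dots,M_s)\mapsto(M_s^*,\dots,M_1^* )$ is a bijection between the set of flag $F$-matroids on $E$ of rank $(r_1,\dots,r_s)$ and the set of flag $F$-matroids on $E$ of rank $(n-r_s,\dots,n-r_1)$.
   Context: A tract is a commutative multiplicative monoid $F$ with identity $1$ and absorbing element $0$ such that $F^\times=F\setminus\{0\}$ is a group, together with a subset $N_F\subseteq\mathbb{N}[F^\times]$ (the nullset) such that $0\in N_F$, $1\notin N_F$, there is a unique $\epsilon\in F^\times$ with $1+\epsilon\in N_F$, and $N_F$ is stable under multiplication by $F^\times$. An involution is a tract morphism $\tau:F\to F$ with $\tau^2=\mathrm{id}$; write $\overline x=\tau(x)$. A Grassmann–Plücker function of rank $r$ on $E$ is a map $\varphi:E^r\to F$, not identically zero, alternating (swapping two arguments multiplies the value by $\epsilon$; value $0$ if two arguments coincide), with $\sum_{k=1}^{r+1}\epsilon^k\varphi(y_1,\dots,\widehat{y_k},\dots,y_{r+1})\varphi(y_k,x_1,\dots,x_{r-1})\in N_F$ for all $x_i,y_j\in E$. An $F$-matroid of rank $r$ is a class $[\varphi]$ modulo multiplication by $F^\times$. Its dual $M^*$ is represented by $\varphi^*(x_1,\dots,x_{n-r})=\mathrm{sign}(x_1,\dots,x_{n-r},x'_1,\dots,x'_r)\,\overline{\varphi(x'_1,\dots,x'_r)}$ whenever $E=\{x_1,\dots,x_{n-r},x'_1,\dots,x'_r\}$ (and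 $0$ otherwise), $\mathrm{sign}$ being the sign of the sorting permutation with $-1$ read as $\epsilon$. If $M=[\mu]$, $N=[\nu]$ have ranks $r,w$, then $N\twoheadrightarrow M$ means $\sum_{k=1}^{w+1}\epsilon^k\nu(y_1,\dots,\widehat{y_k},\dots,y_{w+1})\mu(y_k,x_1,\dots,x_{r-1})\in N_F$ for all $y_1,\dots,y_{w+1},x_1,\dots,x_{r-1}\in E$. A flag $F$-matroid is a sequence $(M_1,\dots,M_s)$ of $F$-matroids on $E$ with $M_j\twoheadrightarrow M_i$ for all $1\le i<j\le s$; its rank is $(\mathrm{rk}M_1,\dots,\mathrm{rk}M_s)$. *)

theory Defs
  imports "HOL-Algebra.Group" "HOL-Combinatorics.Permutations"
begin

text \<open>
  An element of \<open>\<nat>[F\<^sup>\<times>]\<close>, i.e. a finite formal sum of nonzero elements of \<open>F\<close>, is a finite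
  multiset over \<open>F\<^sup>\<times>\<close>: the sum \<open>0\<close> is \<open>{#}\<close> and the sum \<open>a + b\<close> is \<open>{#a, b#}\<close>.
\<close>

record 'a tract = "'a monoid" +
  tzero :: 'a
  nullset :: "'a multiset set"

definition tract_units :: "('a, 'b) tract_scheme \<Rightarrow> 'a set" where
  "tract_units F = carrier F - {tzero F}"

locale tract = comm_monoid F for F :: "('a, 'b) tract_scheme" (structure) +
  assumes tzero_closed: "tzero F \<in> carrier F"
    and tzero_absorb: "x \<in> carrier F \<Longrightarrow> tzero F \<otimes> x = tzero F"
    and units_group: "group (F\<lparr>carrier := tract_units F\<rparr>)"
    and nullset_subset: "A \<in> nullset F \<Longrightarrow> set_mset A \<subseteq> tract_units F"
    and zero_in_nullset: "{#} \<in> nullset F"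
    and one_notin_nullset: "{#\<one>#} \<notin> nullset F"
    and ex1_eps: "\<exists>!e. e \<in> tract_units F \<and> {#\<one>, e#} \<in> nullset F"
    and nullset_stable:
      "c \<in> tract_units F \<Longrightarrow> A \<in> nullset F \<Longrightarrow> image_mset (\<lambda>a. c \<otimes> a) A \<in> nullset F"

definition tract_eps :: "('a, 'b) tract_scheme \<Rightarrow> 'a" where
  "tract_eps F = (THE e. e \<in> tract_units F \<and> {#\<one>\<^bsub>F\<^esub>, e#} \<in> nullset F)"

definition tract_morphism ::
    "('a, 'b) tract_scheme \<Rightarrow> ('c, 'd) tract_scheme \<Rightarrow> ('a \<Rightarrow> 'c) \<Rightarrow> bool" where
  "tract_morphism F G f \<longleftrightarrow>
     f \<in> hom F G \<and> f \<one>\<^bsub>F\<^esub> = \<one>\<^bsub>G\<^esub> \<and> f (tzero F) = tzero G \<and>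
     (\<forall>A\<in>nullset F. image_mset f A \<in> nullset G)"

definition tract_involution :: "('a, 'b) tract_scheme \<Rightarrow> ('a \<Rightarrow> 'a) \<Rightarrow> bool" where
  "tract_involution F \<tau> \<longleftrightarrow> tract_morphism F F \<tau> \<and> (\<forall>x\<in>carrier F. \<tau> (\<tau> x) = x)"

text \<open>
  The canonical map \<open>F \<rightarrow> \<nat>[F\<^sup>\<times>]\<close>; sums of elements of \<open>F\<close> in \<open>\<nat>[F\<^sup>\<times>]\<close> are taken through it,
  so that zero terms are dropped.
\<close>

definition formal :: "('a, 'b) tract_scheme \<Rightarrow> 'a \<Rightarrow> 'a multiset" where
  "formal F a = (if a = tzero F then {#} else {#a#})"

text \<open>\<open>tuples n r\<close> is \<open>E\<^sup>r\<close> for \<open>E = {1..n}\<close>.\<close>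

definition tuples :: "nat \<Rightarrow> nat \<Rightarrow> nat list set" where
  "tuples n r = {xs. length xs = r \<and> set xs \<subseteq> {1..n}}"

text \<open>
  The relations between \<open>\<nu> : E\<^sup>w \<rightarrow> F\<close> and \<open>\<mu> : E\<^sup>r \<rightarrow> F\<close>. List positions start at 0, hence
  the exponent \<open>Suc k\<close>. For \<open>r = 0\<close> there are no tuples \<open>(x\<^sub>1, \<dots>, x\<^sub>r\<^sub>-\<^sub>1)\<close> and the condition is
  empty; the premise \<open>1 \<le> r\<close> is needed because natural subtraction truncates.
\<close>

definition pluecker_rel ::
    "('a, 'b) tract_scheme \<Rightarrow> nat \<Rightarrow> nat \<Rightarrow> (nat list \<Rightarrow> 'a) \<Rightarrow> nat \<Rightarrow> (nat list \<Rightarrow> 'a) \<Rightarrow> bool"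
  where
  "pluecker_rel F n w \<nu> r \<mu> \<longleftrightarrow>
     (1 \<le> r \<longrightarrow>
       (\<forall>ys\<in>tuples n (w + 1). \<forall>xs\<in>tuples n (r - 1).
         (\<Sum>k<w + 1. formal F
            (tract_eps F [^]\<^bsub>F\<^esub> Suc k \<otimes>\<^bsub>F\<^esub>
              (\<nu> (take k ys @ drop (Suc k) ys) \<otimes>\<^bsub>F\<^esub> \<mu> (ys ! k # xs)))) \<in> nullset F))"

definition alternating :: "('a, 'b) tract_scheme \<Rightarrow> nat \<Rightarrow> nat \<Rightarrow> (nat list \<Rightarrow> 'a) \<Rightarrow> bool" where
  "alternating F n r \<phi> \<longleftrightarrow>
     (\<forall>xs\<in>tuples n r.
        (\<forall>i j. i < j \<and> j < r \<longrightarrow>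
            \<phi> (xs[i := xs ! j, j := xs ! i]) = tract_eps F \<otimes>\<^bsub>F\<^esub> \<phi> xs) \<and>
        (\<not> distinct xs \<longrightarrow> \<phi> xs = tzero F))"

text \<open>
  A map \<open>E\<^sup>r \<rightarrow> F\<close> is represented by its extension by zero to all lists. A value in
  \<open>F\<close> outside the domain other than \<open>tzero F\<close> (such as \<open>undefined\<close>) would allow the
  same function to represent maps with different \<open>r\<close>; nonzero maps extended by zero determine \<open>r\<close>.
\<close>

definition gp_function :: "('a, 'b) tract_scheme \<Rightarrow> nat \<Rightarrow> nat \<Rightarrow> (nat list \<Rightarrow> 'a) \<Rightarrow> bool" where
  "gp_function F n r \<phi> \<longleftrightarrow>
     (\<forall>xs\<in>tuples n r. \<phi> xs \<in> carrier F) \<and>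
     (\<forall>xs. xs \<notin> tuples n r \<longrightarrow> \<phi> xs = tzero F) \<and>
     (\<exists>xs\<in>tuples n r. \<phi> xs \<noteq> tzero F) \<and>
     alternating F n r \<phi> \<and>
     pluecker_rel F n r \<phi> r \<phi>"

definition gp_class :: "('a, 'b) tract_scheme \<Rightarrow> (nat list \<Rightarrow> 'a) \<Rightarrow> (nat list \<Rightarrow> 'a) set" where
  "gp_class F \<phi> = {\<lambda>xs. c \<otimes>\<^bsub>F\<^esub> \<phi> xs | c. c \<in> tract_units F}"

definition matroid_of_rank ::
    "('a, 'b) tract_scheme \<Rightarrow> nat \<Rightarrow> nat \<Rightarrow> (nat list \<Rightarrow> 'a) set \<Rightarrow> bool" where
  "matroid_of_rank F n r M \<longleftrightarrow> (\<exists>\<phi>. gp_function F n r \<phi> \<and> M = gp_class F \<phi>)"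

definition tract_matroid :: "('a, 'b) tract_scheme \<Rightarrow> nat \<Rightarrow> (nat list \<Rightarrow> 'a) set \<Rightarrow> bool" where
  "tract_matroid F n M \<longleftrightarrow> (\<exists>r. matroid_of_rank F n r M)"

definition rk :: "('a, 'b) tract_scheme \<Rightarrow> nat \<Rightarrow> (nat list \<Rightarrow> 'a) set \<Rightarrow> nat" where
  "rk F n M = (THE r. matroid_of_rank F n r M)"

text \<open>
  The sign of an ordering \<open>zs\<close> of \<open>{1..length zs}\<close>, with \<open>-1\<close> read as \<open>\<epsilon>\<close>. The permutation
  \<open>i \<mapsto> zs\<^sub>i\<close> below is the inverse of the one sorting \<open>zs\<close> and has the same sign.
\<close>

definition list_perm :: "nat list \<Rightarrow> nat \<Rightarrow> nat" where
  "list_perm zs i = (if i \<in> {1..length zs} then zs ! (i - 1) else i)"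

definition tract_sign :: "('a, 'b) tract_scheme \<Rightarrow> nat list \<Rightarrow> 'a" where
  "tract_sign F zs = (if evenperm (list_perm zs) then \<one>\<^bsub>F\<^esub> else tract_eps F)"

text \<open>
  The complement of \<open>xs\<close> is listed in increasing order; any other order gives the same value, see
  \<open>dual_fun_eq\<close> below.
\<close>

definition dual_fun ::
    "('a, 'b) tract_scheme \<Rightarrow> ('a \<Rightarrow> 'a) \<Rightarrow> nat \<Rightarrow> nat \<Rightarrow> (nat list \<Rightarrow> 'a) \<Rightarrow> nat list \<Rightarrow> 'a" where
  "dual_fun F \<tau> n r \<phi> xs =
     (if xs \<in> tuples n (n - r) \<and> distinct xs
      then (let ys = sorted_list_of_set ({1..n} - set xs)
            in tract_sign F (xs @ ys) \<otimes>\<^bsub>F\<^esub> \<tau> (\<phi> ys))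
      else tzero F)"

definition dual ::
    "('a, 'b) tract_scheme \<Rightarrow> ('a \<Rightarrow> 'a) \<Rightarrow> nat \<Rightarrow> (nat list \<Rightarrow> 'a) set \<Rightarrow> (nat list \<Rightarrow> 'a) set" where
  "dual F \<tau> n M = (\<Union>\<phi>\<in>M. gp_class F (dual_fun F \<tau> n (rk F n M) \<phi>))"

text \<open>
  \<open>tract_quotient F n N M\<close> is \<open>N \<twoheadrightarrow> M\<close>. The relations do not depend on the representatives, see
  \<open>tract_quotient_iff\<close> below.
\<close>

definition tract_quotient ::
    "('a, 'b) tract_scheme \<Rightarrow> nat \<Rightarrow> (nat list \<Rightarrow> 'a) set \<Rightarrow> (nat list \<Rightarrow> 'a) set \<Rightarrow> bool" where
  "tract_quotient F n N M \<longleftrightarrow>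
     (\<forall>\<nu>\<in>N. \<forall>\<mu>\<in>M. pluecker_rel F n (rk F n N) \<nu> (rk F n M) \<mu>)"

definition flag_matroid :: "('a, 'b) tract_scheme \<Rightarrow> nat \<Rightarrow> (nat list \<Rightarrow> 'a) set list \<Rightarrow> bool" where
  "flag_matroid F n Ms \<longleftrightarrow>
     (\<forall>M\<in>set Ms. tract_matroid F n M) \<and>
     (\<forall>i j. i < j \<and> j < length Ms \<longrightarrow> tract_quotient F n (Ms ! j) (Ms ! i))"

definition flag_matroids_of_rank ::
    "('a, 'b) tract_scheme \<Rightarrow> nat \<Rightarrow> nat list \<Rightarrow> (nat list \<Rightarrow> 'a) set list set" where
  "flag_matroids_of_rank F n rs = {Ms. flag_matroid F n Ms \<and> map (rk F n) Ms = rs}"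


subsection \<open>Well-definedness\<close>

context tract
begin

lemma one_unit: "\<one> \<in> tract_units F"
proof -
  interpret G: group "F\<lparr>carrier := tract_units F\<rparr>" by (rule units_group)
  show ?thesis using G.one_closed by simp
qed

lemma unit_mult: "a \<in> tract_units F \<Longrightarrow> b \<in> tract_units F \<Longrightarrow> a \<otimes> b \<in> tract_units F"
proof -
  interpret G: group "F\<lparr>carrier := tract_units F\<rparr>" by (rule units_group)
  show "a \<in> tract_units F \<Longrightarrow> b \<in> tract_units F \<Longrightarrow> ?thesis" using G.m_closed by simp
qed

lemma unit_inv:
  assumes "a \<in> tract_units F"
  obtains b where "b \<in> tract_units F" "a \<otimes> b = \<one>" "b \<otimes> a = \<one>"
proof -
  interpret G: group "F\<lparr>carrier := tract_units F\<rparr>" by (rule units_group)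
  show ?thesis using G.r_inv[of a] G.l_inv[of a] G.inv_closed[of a] assms that by simp
qed

lemma unit_carrier: "a \<in> tract_units F \<Longrightarrow> a \<in> carrier F"
  by (simp add: tract_units_def)

lemma tzero_absorb': "x \<in> carrier F \<Longrightarrow> x \<otimes> tzero F = tzero F"
  using tzero_absorb[of x] m_comm[OF tzero_closed, of x] by simp

lemma eps_unit: "tract_eps F \<in> tract_units F"
  and eps_null: "{#\<one>, tract_eps F#} \<in> nullset F"
  using theI'[OF ex1_eps] by (auto simp: tract_eps_def)

lemma eps_unique: "e \<in> tract_units F \<Longrightarrow> {#\<one>, e#} \<in> nullset F \<Longrightarrow> e = tract_eps F"
  using ex1_eps eps_unit eps_null by blast

lemma eps_carrier: "tract_eps F \<in> carrier F"
  using eps_unit unit_carrier by blast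

lemma eps_eps: "tract_eps F \<otimes> tract_eps F = \<one>"
proof -
  obtain b where b: "b \<in> tract_units F" "tract_eps F \<otimes> b = \<one>" "b \<otimes> tract_eps F = \<one>"
    using unit_inv[OF eps_unit] .
  have "image_mset (\<lambda>a. b \<otimes> a) {#\<one>, tract_eps F#} \<in> nullset F"
    using nullset_stable[OF b(1) eps_null] .
  then have "{#\<one>, b#} \<in> nullset F"
    using b unit_carrier by (simp add: add_mset_commute)
  then show ?thesis using eps_unique[OF b(1)] b by simp
qed

lemma matroid_of_rank_unique:
  assumes "matroid_of_rank F n r M" "matroid_of_rank F n r' M"
  shows "r = r'"
proof -
  obtain \<phi> \<psi> where 1: "gp_function F n r \<phi>" "M = gp_class F \<phi>"
    and 2: "gp_function F n r' \<psi>" "M = gp_class F \<psi>"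
    using assms by (auto simp: matroid_of_rank_def)
  obtain xs where xs: "xs \<in> tuples n r" "\<phi> xs \<noteq> tzero F" "\<phi> xs \<in> carrier F"
    using 1 by (auto simp: gp_function_def)
  have "(\<lambda>xs. \<one> \<otimes> \<phi> xs) \<in> gp_class F \<psi>"
    using 1 2 one_unit by (auto simp: gp_class_def)
  then obtain c where c: "c \<in> tract_units F" "\<And>xs. \<one> \<otimes> \<phi> xs = c \<otimes> \<psi> xs"
    unfolding gp_class_def by (auto dest: fun_cong)
  have "\<phi> xs = c \<otimes> \<psi> xs" using c(2)[of xs] xs by simp
  then have "\<psi> xs \<noteq> tzero F" using xs(2) c(1) tzero_absorb' unit_carrier by auto
  then have "xs \<in> tuples n r'" using 2(1) by (auto simp: gp_function_def)
  then show ?thesis using xs(1) by (simp add: tuples_def)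
qed

lemma rk_eq: "matroid_of_rank F n r M \<Longrightarrow> rk F n M = r"
  unfolding rk_def using matroid_of_rank_unique by blast

lemma formal_scale:
  assumes "c \<in> tract_units F" "a \<in> carrier F"
  shows "formal F (c \<otimes> a) = image_mset (\<lambda>a. c \<otimes> a) (formal F a)"
proof (cases "a = tzero F")
  case True
  then show ?thesis using assms tzero_absorb' unit_carrier by (simp add: formal_def)
next
  case False
  then have "c \<otimes> a \<in> tract_units F" using assms unit_mult by (simp add: tract_units_def)
  then show ?thesis using False by (simp add: formal_def tract_units_def)
qed

lemma pluecker_rel_scale:
  assumes "c \<in> tract_units F" "d \<in> tract_units F"
    and "\<And>xs. \<nu> xs \<in> carrier F" "\<And>xs. \<mu> xs \<in> carrier F"
    and "pluecker_rel F n w \<nu> r \<mu>"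
  shows "pluecker_rel F n w (\<lambda>xs. c \<otimes> \<nu> xs) r (\<lambda>xs. d \<otimes> \<mu> xs)"
  unfolding pluecker_rel_def
proof (intro impI ballI)
  fix ys xs assume *: "1 \<le> r" "ys \<in> tuples n (w + 1)" "xs \<in> tuples n (r - 1)"
  let ?t = "\<lambda>k. tract_eps F [^] Suc k \<otimes> (\<nu> (take k ys @ drop (Suc k) ys) \<otimes> \<mu> (ys ! k # xs))"
  have cd: "c \<otimes> d \<in> tract_units F" using assms unit_mult by simp
  have "tract_eps F [^] Suc k \<otimes> ((c \<otimes> \<nu> (take k ys @ drop (Suc k) ys)) \<otimes> (d \<otimes> \<mu> (ys ! k # xs)))
      = (c \<otimes> d) \<otimes> ?t k" for k
    using assms(3,4) unit_carrier[OF assms(1)] unit_carrier[OF assms(2)]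
      nat_pow_closed[OF eps_carrier, of "Suc k"]
    by (simp add: m_ac del: nat_pow_Suc)
  then have "(\<Sum>k<w + 1. formal F
       (tract_eps F [^] Suc k \<otimes> ((c \<otimes> \<nu> (take k ys @ drop (Suc k) ys)) \<otimes> (d \<otimes> \<mu> (ys ! k # xs)))))
     = (\<Sum>k<w + 1. image_mset (\<lambda>a. (c \<otimes> d) \<otimes> a) (formal F (?t k)))"
    using assms(3,4) eps_carrier by (simp add: formal_scale[OF cd] del: sum.lessThan_Suc)
  also have "\<dots> = image_mset (\<lambda>a. (c \<otimes> d) \<otimes> a) (\<Sum>k<w + 1. formal F (?t k))"
    by (induction w) auto
  finally show "(\<Sum>k<w + 1. formal F
       (tract_eps F [^] Suc k \<otimes> ((c \<otimes> \<nu> (take k ys @ drop (Suc k) ys)) \<otimes> (d \<otimes> \<mu> (ys ! k # xs)))))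
      \<in> nullset F"
    using nullset_stable[OF cd] assms(5) * by (simp add: pluecker_rel_def del: sum.lessThan_Suc)
qed

lemma gp_function_carrier: "gp_function F n r \<phi> \<Longrightarrow> \<phi> xs \<in> carrier F"
  using tzero_closed by (cases "xs \<in> tuples n r") (auto simp: gp_function_def)

lemma tract_quotient_iff:
  assumes "gp_function F n w \<nu>" "gp_function F n r \<mu>"
  shows "tract_quotient F n (gp_class F \<nu>) (gp_class F \<mu>) \<longleftrightarrow> pluecker_rel F n w \<nu> r \<mu>"
proof -
  have rk: "rk F n (gp_class F \<nu>) = w" "rk F n (gp_class F \<mu>) = r"
    using assms by (auto intro!: rk_eq simp: matroid_of_rank_def)
  have "\<nu> = (\<lambda>xs. \<one> \<otimes> \<nu> xs)" "\<mu> = (\<lambda>xs. \<one> \<otimes> \<mu> xs)"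
    using assms gp_function_carrier by (auto simp: fun_eq_iff)
  then have "\<nu> \<in> gp_class F \<nu>" "\<mu> \<in> gp_class F \<mu>"
    using one_unit unfolding gp_class_def by blast+
  moreover have "pluecker_rel F n w \<nu>' r \<mu>'"
    if "pluecker_rel F n w \<nu> r \<mu>" "\<nu>' \<in> gp_class F \<nu>" "\<mu>' \<in> gp_class F \<mu>" for \<nu>' \<mu>'
    using that pluecker_rel_scale assms gp_function_carrier unfolding gp_class_def by blast
  ultimately show ?thesis unfolding tract_quotient_def rk by blast
qed

lemma involution_eps:
  assumes "tract_involution F \<tau>"
  shows "\<tau> (tract_eps F) = tract_eps F"
proof (rule eps_unique)
  have m: "\<tau> \<in> hom F F" "\<tau> \<one> = \<one>" "\<And>A. A \<in> nullset F \<Longrightarrow> image_mset \<tau> A \<in> nullset F"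
    using assms by (auto simp: tract_involution_def tract_morphism_def)
  show *: "{#\<one>, \<tau> (tract_eps F)#} \<in> nullset F" using m(3)[OF eps_null] m(2) by simp
  show "\<tau> (tract_eps F) \<in> tract_units F" using nullset_subset[OF *] by simp
qed

lemma list_perm_permutes:
  assumes "distinct zs" "set zs = {1..length zs}"
  shows "list_perm zs permutes {1..length zs}"
proof (rule bij_imp_permutes)
  have "bij_betw (\<lambda>i. zs ! i) {..<length zs} {1..length zs}"
    using bij_betw_nth[OF assms(1) refl refl] assms(2) by simp
  moreover have "bij_betw (\<lambda>i. i - 1) {1..length zs} {..<length zs}"
    by (rule bij_betwI[of _ _ _ Suc]) auto
  ultimately have "bij_betw ((\<lambda>i. zs ! i) \<circ> (\<lambda>i. i - 1)) {1..length zs} {1..length zs}"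
    by (rule bij_betw_trans[rotated])
  then show "bij_betw (list_perm zs) {1..length zs} {1..length zs}"
    by (rule bij_betw_cong[THEN iffD1, rotated]) (simp add: list_perm_def)
qed (auto simp: list_perm_def)

lemma tract_sign_swap:
  assumes "distinct zs" "set zs = {1..length zs}" "i < j" "j < length zs"
  shows "tract_sign F (zs[i := zs ! j, j := zs ! i]) = tract_eps F \<otimes> tract_sign F zs"
proof -
  have p: "permutation (list_perm zs)"
    using list_perm_permutes[OF assms(1,2)] permutation_permutes by blast
  have "list_perm (zs[i := zs ! j, j := zs ! i]) = list_perm zs \<circ> Transposition.transpose (Suc i) (Suc j)"
  proof
    fix k
    show "list_perm (zs[i := zs ! j, j := zs ! i]) k
        = (list_perm zs \<circ> Transposition.transpose (Suc i) (Suc j)) k"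
      using assms(3,4)
      by (cases k) (auto simp: list_perm_def Transposition.transpose_def nth_list_update)
  qed
  then have "evenperm (list_perm (zs[i := zs ! j, j := zs ! i])) \<longleftrightarrow> \<not> evenperm (list_perm zs)"
    using assms(3) by (simp add: evenperm_comp[OF p permutation_swap_id] evenperm_swap)
  then show ?thesis using eps_eps eps_carrier by (simp add: tract_sign_def)
qed

lemma permute_list_transpose:
  assumes "i < length ys" "j < length ys"
  shows "permute_list (Transposition.transpose i j) ys = ys[i := ys ! j, j := ys ! i]"
  using assms
  by (intro nth_equalityI) (auto simp: permute_list_def Transposition.transpose_def nth_list_update)

lemma swap_invariant:
  assumes inv: "\<And>i j zs. mset zs = mset ys \<Longrightarrow> i < j \<Longrightarrow> j < length zs \<Longrightarrow>
      g (zs[i := zs ! j, j := zs ! i]) = g zs"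
    and "mset ys' = mset ys"
  shows "g ys' = g ys"
proof -
  obtain p where p: "p permutes {..<length ys}" "permute_list p ys = ys'"
    using mset_eq_permutation[OF assms(2)] .
  have "g (permute_list p ys) = g ys"
    using finite_lessThan p(1)
  proof (induction rule: permutes_rev_induct)
    case (swap a b p)
    let ?zs = "permute_list p ys"
    have "permute_list (p \<circ> Transposition.transpose a b) ys
        = permute_list (Transposition.transpose a b) ?zs"
      using swap.hyps by (intro permute_list_compose permutes_swap_id) auto
    also have "\<dots> = ?zs[a := ?zs ! b, b := ?zs ! a]"
      using swap.hyps by (intro permute_list_transpose) auto
    finally have eq: "permute_list (p \<circ> Transposition.transpose a b) ys
        = ?zs[a := ?zs ! b, b := ?zs ! a]" .
    have m: "mset ?zs = mset ys" using swap.hyps by simp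
    show ?case
    proof (cases "a < b")
      case True
      then show ?thesis unfolding eq using inv[OF m, of a b] swap by simp
    next
      case False
      then have "b < a" using swap by simp
      then show ?thesis unfolding eq using inv[OF m, of b a] swap by (simp add: list_update_swap)
    qed
  qed simp
  then show ?thesis using p by simp
qed

lemma dual_fun_eq:
  assumes \<tau>: "tract_involution F \<tau>" and \<phi>: "gp_function F n r \<phi>"
    and xs: "distinct (xs @ ys)" "set (xs @ ys) = {1..n}" "length ys = r"
  shows "dual_fun F \<tau> n r \<phi> xs = tract_sign F (xs @ ys) \<otimes> \<tau> (\<phi> ys)"
proof -
  let ?g = "\<lambda>ys. tract_sign F (xs @ ys) \<otimes> \<tau> (\<phi> ys)"
  let ?ys = "sorted_list_of_set ({1..n} - set xs)"
  have hom: "\<tau> \<in> hom F F" using \<tau> by (auto simp: tract_involution_def tract_morphism_def)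
  have n: "length xs + r = n" using distinct_card[OF xs(1)] xs(2,3) by simp
  have inv: "?g (zs[i := zs ! j, j := zs ! i]) = ?g zs"
    if zs: "mset zs = mset ys" "i < j" "j < length zs" for i j zs
  proof -
    have l: "length zs = r" and s: "set zs = set ys" and d: "distinct zs"
      using mset_eq_length[OF zs(1)] mset_eq_setD[OF zs(1)] mset_eq_imp_distinct_iff[OF zs(1)] xs
      by simp_all
    have t: "zs \<in> tuples n r" using l s xs by (auto simp: tuples_def)
    have "xs @ zs[i := zs ! j, j := zs ! i]
        = (xs @ zs)[length xs + i := (xs @ zs) ! (length xs + j),
                    length xs + j := (xs @ zs) ! (length xs + i)]"
      by (simp add: list_update_append)
    moreover have "distinct (xs @ zs)" "set (xs @ zs) = {1..length (xs @ zs)}"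
      using s d xs l n by auto
    ultimately have sg: "tract_sign F (xs @ zs[i := zs ! j, j := zs ! i])
        = tract_eps F \<otimes> tract_sign F (xs @ zs)"
      using tract_sign_swap[of "xs @ zs" "length xs + i" "length xs + j"] zs(2,3) by simp
    have "\<phi> (zs[i := zs ! j, j := zs ! i]) = tract_eps F \<otimes> \<phi> zs"
      using \<phi> t zs(2,3) l by (auto simp: gp_function_def alternating_def)
    then have \<phi>s: "\<tau> (\<phi> (zs[i := zs ! j, j := zs ! i])) = tract_eps F \<otimes> \<tau> (\<phi> zs)"
      using hom_mult[OF hom eps_carrier gp_function_carrier[OF \<phi>]] involution_eps[OF \<tau>] by simp
    have c: "tract_sign F (xs @ zs) \<in> carrier F" "\<tau> (\<phi> zs) \<in> carrier F"
      using eps_carrier hom_in_carrier[OF hom gp_function_carrier[OF \<phi>]]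
      by (auto simp: tract_sign_def)
    have "?g (zs[i := zs ! j, j := zs ! i])
        = (tract_eps F \<otimes> tract_eps F) \<otimes> ?g zs"
      unfolding sg \<phi>s using c eps_carrier by (simp add: m_ac)
    then show ?thesis using c eps_eps by simp
  qed
  have "set ?ys = set ys" "distinct ?ys" "distinct ys" using xs by auto
  then have "mset ?ys = mset ys" using set_eq_iff_mset_eq_distinct by blast
  then have "?g ?ys = ?g ys" using swap_invariant[where g = ?g] inv by blast
  moreover have "xs \<in> tuples n (n - r)" "distinct xs" using xs n by (auto simp: tuples_def)
  ultimately show ?thesis unfolding dual_fun_def Let_def by simp
qed

end

end

theory Submission
  imports Defs
begin

text \<open>
  Everything reduces to one computation. Let \<open>ys\<close> and \<open>xs\<close> be injective tuples, let \<open>xs'\<close> list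
  the complement of \<open>ys\<close> and \<open>ys'\<close> that of \<open>xs\<close>. If \<open>y\<^sub>k = y'\<^sub>l\<close>, then moving this
  entry to the appropriate place in \<open>ys @ xs'\<close> and in \<open>xs @ ys'\<close> shows that the \<open>k\<close>-th term of
  the relation between \<open>\<mu>\<^sup>*\<close> and \<open>\<nu>\<^sup>*\<close> at \<open>(ys, xs)\<close> is, up to a unit independent of \<open>k\<close> and \<open>l\<close>,
  the conjugate of the \<open>l\<close>-th term of the relation between \<open>\<nu>\<close> and \<open>\<mu>\<close> at \<open>(ys', xs')\<close>; all terms
  without a partner vanish. If \<open>ys\<close> has a repeated entry, at most two terms survive, and they
  have the form \<open>t\<close> and \<open>\<epsilon> t\<close>. Applied to \<open>\<nu> = \<mu>\<close> this shows that duals are matroids,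
  and in general that duality reverses quotients. Finally \<open>\<phi>\<^sup>*\<^sup>*\<close> is a unit multiple of \<open>\<phi>\<close>, so
  duality is its own inverse on flags.
\<close>

subsection \<open>Lists, multisets and sums\<close>

definition remove_nth :: "nat \<Rightarrow> 'a list \<Rightarrow> 'a list" where
  "remove_nth k xs = take k xs @ drop (Suc k) xs"

lemma length_remove_nth: "k < length xs \<Longrightarrow> length (remove_nth k xs) = length xs - 1"
  by (simp add: remove_nth_def)

lemma set_remove_nth_subset: "set (remove_nth k xs) \<subseteq> set xs"
  by (auto simp: remove_nth_def dest: in_set_takeD in_set_dropD)

lemma remove_nth_append_Cons: "remove_nth (length us) (us @ a # vs) = us @ vs"
  by (simp add: remove_nth_def)

lemma remove_nth_conv_map:
  assumes "k < length xs"
  shows "remove_nth k xs = map ((!) xs) ([0..<k] @ [Suc k..<length xs])"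
  using assms by (intro nth_equalityI) (auto simp: remove_nth_def nth_append)

lemma distinct_remove_nth_imp:
  assumes "distinct (remove_nth k xs)" "k < length xs"
    and "i < j" "j < length xs" "xs ! i = xs ! j"
  shows "k = i \<or> k = j"
proof (rule ccontr)
  assume "\<not> (k = i \<or> k = j)"
  then have "i \<in> set ([0..<k] @ [Suc k..<length xs])" "j \<in> set ([0..<k] @ [Suc k..<length xs])"
    using assms(3,4) by auto
  moreover have "inj_on ((!) xs) (set ([0..<k] @ [Suc k..<length xs]))"
    using assms(1) unfolding remove_nth_conv_map[OF assms(2)] distinct_map by blast
  ultimately show False using assms(3,5) by (metis inj_onD less_irrefl)
qed

lemma mset_eq_mset_set_iff:
  assumes "finite A"
  shows "mset xs = mset_set A \<longleftrightarrow> distinct xs \<and> set xs = A"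
proof
  assume mset_eq: "mset xs = mset_set A"
  then have "set xs = A" using assms by (metis finite_set_mset_mset_set set_mset_mset)
  moreover have "distinct xs"
    using mset_eq assms \<open>set xs = A\<close> by (simp add: distinct_count_atmost_1)
  ultimately show "distinct xs \<and> set xs = A" by simp
qed (auto simp: mset_set_set)

lemma mset_append_complement:
  assumes "finite A" "distinct xs" "set xs \<subseteq> A"
  shows "mset (xs @ sorted_list_of_set (A - set xs)) = mset_set A"
  using assms by (subst mset_eq_mset_set_iff) auto

lemma distinct_tuple_length_le: "xs \<in> tuples n r \<Longrightarrow> distinct xs \<Longrightarrow> r \<le> n"
  using card_mono[of "{1..n}" "set xs"] by (simp add: tuples_def distinct_card)

lemma complement_tuple:
  assumes "xs \<in> tuples n r" "distinct xs"
  obtains ys where "ys \<in> tuples n (n - r)" "mset (xs @ ys) = mset_set {1..n}"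
proof
  let ?ys = "sorted_list_of_set ({1..n} - set xs)"
  have "card (set xs) = r" "set xs \<subseteq> {1..n}"
    using assms distinct_card[of xs] by (auto simp: tuples_def)
  then show "?ys \<in> tuples n (n - r)"
    by (auto simp: tuples_def card_Diff_subset)
  show "mset (xs @ ?ys) = mset_set {1..n}"
    using assms by (intro mset_append_complement) (auto simp: tuples_def)
qed

lemma image_mset_sum: "image_mset f (\<Sum>i\<in>I. A i) = (\<Sum>i\<in>I. image_mset f (A i))"
  by (induction I rule: infinite_finite_induct) auto

lemma sum_reindex_inv_into:
  fixes f :: "'b \<Rightarrow> 'c::comm_monoid_add"
  assumes "finite A" "inj_on p A"
    and "\<And>a. a \<in> A \<Longrightarrow> p a \<notin> S \<Longrightarrow> f a = 0"
  shows "sum f A = (\<Sum>x\<in>p ` A \<inter> S. f (inv_into A p x))"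
proof -
  have "sum f A = (\<Sum>x\<in>p ` A. f (inv_into A p x))"
    using assms(2) by (simp add: sum.reindex)
  also have "\<dots> = (\<Sum>x\<in>p ` A \<inter> S. f (inv_into A p x))"
  proof (rule sum.mono_neutral_right)
    show "\<forall>x\<in>p ` A - p ` A \<inter> S. f (inv_into A p x) = 0"
    proof
      fix x assume "x \<in> p ` A - p ` A \<inter> S"
      then obtain a where "a \<in> A" "x = p a" "p a \<notin> S" by blast
      then show "f (inv_into A p x) = 0" using assms(2,3) by simp
    qed
  qed (use assms(1) in auto)
  finally show ?thesis .
qed

lemma sum_eq_if_matching:
  fixes f :: "'b \<Rightarrow> 'c::comm_monoid_add"
  assumes "finite A" "inj_on p A" and "finite B" "inj_on q B"
    and matched: "\<And>a b. a \<in> A \<Longrightarrow> b \<in> B \<Longrightarrow> p a = q b \<Longrightarrow> f a = g b"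
    and "\<And>a. a \<in> A \<Longrightarrow> p a \<notin> q ` B \<Longrightarrow> f a = 0"
      "\<And>b. b \<in> B \<Longrightarrow> q b \<notin> p ` A \<Longrightarrow> g b = 0"
  shows "sum f A = sum g B"
proof -
  have "sum f A = (\<Sum>x\<in>p ` A \<inter> q ` B. f (inv_into A p x))"
    using assms by (intro sum_reindex_inv_into)
  also have "\<dots> = (\<Sum>x\<in>q ` B \<inter> p ` A. g (inv_into B q x))"
    by (intro sum.cong matched) (auto simp: inv_into_into f_inv_into_f)
  also have "\<dots> = sum g B"
    using assms by (intro sum_reindex_inv_into[symmetric])
  finally show ?thesis .
qed

lemma sum_nth_eq_if_matching:
  fixes f :: "nat \<Rightarrow> 'c::comm_monoid_add"
  assumes "distinct xs" "distinct ys"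
    and "\<And>i j. i < length xs \<Longrightarrow> j < length ys \<Longrightarrow> xs ! i = ys ! j \<Longrightarrow> f i = g j"
    and "\<And>i. i < length xs \<Longrightarrow> xs ! i \<notin> set ys \<Longrightarrow> f i = 0"
    and "\<And>j. j < length ys \<Longrightarrow> ys ! j \<notin> set xs \<Longrightarrow> g j = 0"
  shows "(\<Sum>i<length xs. f i) = (\<Sum>j<length ys. g j)"
proof -
  have image_nth: "(!) zs ` {..<length zs} = set zs" for zs :: "'b list"
    using nth_image[of "length zs" zs] by (simp add: lessThan_atLeast0)
  show ?thesis
    by (rule sum_eq_if_matching[where p = "(!) xs" and q = "(!) ys"])
      (use assms in \<open>simp_all add: image_nth inj_on_nth\<close>)
qed

subsection \<open>Signs in a tract\<close>

context tract
begin

abbreviation eps :: 'a (\<open>\<epsilon>\<close>) where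
  "\<epsilon> \<equiv> tract_eps F"

lemma eps_pow_unit: "\<epsilon> [^] (k::nat) \<in> tract_units F"
  by (induction k) (auto simp: one_unit eps_unit unit_mult)

lemma eps_pow_carrier: "\<epsilon> [^] (k::nat) \<in> carrier F"
  by (simp add: eps_carrier)

lemma eps_pow_parity: "\<epsilon> [^] (k::nat) = (if even k then \<one> else \<epsilon>)"
  by (induction k) (auto simp: eps_eps eps_carrier)

lemma eps_pow_eq_if_same_parity: "even (i::nat) \<longleftrightarrow> even (j::nat) \<Longrightarrow> \<epsilon> [^] i = \<epsilon> [^] j"
  by (simp add: eps_pow_parity)

lemma tract_sign_unit: "tract_sign F zs \<in> tract_units F"
  by (simp add: tract_sign_def one_unit eps_unit)

lemma tract_sign_carrier: "tract_sign F zs \<in> carrier F"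
  using tract_sign_unit unit_carrier by blast

lemma tract_sign_square: "tract_sign F zs \<otimes> tract_sign F zs = \<one>"
  by (simp add: tract_sign_def eps_eps)

lemma unit_mult_eq_zero_iff:
  "c \<in> tract_units F \<Longrightarrow> a \<in> carrier F \<Longrightarrow> c \<otimes> a = tzero F \<longleftrightarrow> a = tzero F"
  using unit_mult[of c a] tzero_absorb'[of c] by (auto simp: tract_units_def)

lemma formal_zero: "formal F (tzero F) = {#}"
  by (simp add: formal_def)

lemma formal_add_eps_mult_null:
  assumes "t \<in> carrier F"
  shows "formal F t + formal F (\<epsilon> \<otimes> t) \<in> nullset F"
proof (cases "t = tzero F")
  case True
  then show ?thesis using zero_in_nullset tzero_absorb'[OF eps_carrier] by (simp add: formal_zero)
next
  case False
  then have "t \<in> tract_units F" using assms by (simp add: tract_units_def)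
  from nullset_stable[OF this eps_null] show ?thesis
    using False assms eps_carrier unit_mult_eq_zero_iff[OF eps_unit assms]
    by (simp add: formal_def m_comm add_mset_commute)
qed

definition skew_on :: "('c list \<Rightarrow> 'a) \<Rightarrow> 'c multiset \<Rightarrow> bool" where
  "skew_on g A \<longleftrightarrow>
     (\<forall>zs. mset zs = A \<longrightarrow>
        g zs \<in> carrier F \<and>
        (\<forall>i j. i < j \<and> j < length zs \<longrightarrow> g (zs[i := zs ! j, j := zs ! i]) = \<epsilon> \<otimes> g zs))"

lemma skew_on_carrier: "skew_on g A \<Longrightarrow> mset zs = A \<Longrightarrow> g zs \<in> carrier F"
  by (simp add: skew_on_def)

lemma skew_on_swap:
  "skew_on g A \<Longrightarrow> mset zs = A \<Longrightarrow> i < j \<Longrightarrow> j < length zs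
    \<Longrightarrow> g (zs[i := zs ! j, j := zs ! i]) = \<epsilon> \<otimes> g zs"
  by (simp add: skew_on_def)

lemma skew_on_swap_adjacent:
  assumes "skew_on g A" "mset (us @ a # b # vs) = A"
  shows "g (us @ b # a # vs) = \<epsilon> \<otimes> g (us @ a # b # vs)"
  using skew_on_swap[OF assms, of "length us" "Suc (length us)"]
  by (simp add: list_update_append nth_append)

lemma skew_on_move_entry:
  assumes skew: "skew_on g A" and "mset (us @ a # ws @ vs) = A"
  shows "g (us @ ws @ a # vs) = \<epsilon> [^] length ws \<otimes> g (us @ a # ws @ vs)"
  using assms(2)
proof (induction ws arbitrary: us)
  case Nil
  then show ?case using skew_on_carrier[OF skew] by simp
next
  case (Cons b ws)
  have "g (us @ (b # ws) @ a # vs) = \<epsilon> [^] length ws \<otimes> g (us @ b # a # ws @ vs)"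
    using Cons.IH[of "us @ [b]"] Cons.prems by (simp add: ac_simps add_mset_commute)
  also have "g (us @ b # a # ws @ vs) = \<epsilon> \<otimes> g (us @ a # b # ws @ vs)"
    using Cons.prems by (intro skew_on_swap_adjacent[OF skew]) simp
  finally show ?case using skew_on_carrier[OF skew Cons.prems] eps_carrier by (simp add: m_assoc)
qed

lemma skew_on_exchange_blocks:
  assumes skew: "skew_on g A" and "mset (us @ vs) = A"
  shows "g (vs @ us) = \<epsilon> [^] (length us * length vs) \<otimes> g (us @ vs)"
  using assms(2)
proof (induction us arbitrary: vs)
  case Nil
  then show ?case using skew_on_carrier[OF skew] by simp
next
  case (Cons a us)
  have "g (vs @ a # us) = \<epsilon> [^] (length us * Suc (length vs)) \<otimes> g (us @ vs @ [a])"
    using Cons.IH[of "vs @ [a]"] Cons.prems by simp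
  also have "g (us @ vs @ [a]) = \<epsilon> [^] (length us + length vs) \<otimes> g (a # us @ vs)"
    using skew_on_move_entry[OF skew, of "[]" a "us @ vs" "[]"] Cons.prems by simp
  also have "\<epsilon> [^] (length us * Suc (length vs)) \<otimes> (\<epsilon> [^] (length us + length vs) \<otimes> g (a # us @ vs))
      = \<epsilon> [^] (length us * Suc (length vs) + (length us + length vs)) \<otimes> g (a # us @ vs)"
    using skew_on_carrier[OF skew] Cons.prems by (simp add: eps_carrier flip: m_assoc nat_pow_mult)
  also have "\<epsilon> [^] (length us * Suc (length vs) + (length us + length vs))
      = \<epsilon> [^] (length (a # us) * length vs)"
    by (intro eps_pow_eq_if_same_parity) auto
  finally show ?case by simp
qed

lemma skew_on_append:
  assumes "skew_on g (A + mset vs)"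
  shows "skew_on (\<lambda>zs. g (zs @ vs)) A"
  unfolding skew_on_def
proof (intro allI impI conjI)
  fix zs assume "mset zs = A"
  then have mset_append: "mset (zs @ vs) = A + mset vs" by simp
  show "g (zs @ vs) \<in> carrier F" using skew_on_carrier[OF assms mset_append] .
  fix i j assume "i < j \<and> j < length zs"
  then show "g (zs[i := zs ! j, j := zs ! i] @ vs) = \<epsilon> \<otimes> g (zs @ vs)"
    using skew_on_swap[OF assms mset_append, of i j] by (simp add: list_update_append nth_append)
qed

lemma skew_on_alternating:
  assumes "alternating F n r \<phi>" "range \<phi> \<subseteq> carrier F" "xs \<in> tuples n r"
  shows "skew_on \<phi> (mset xs)"
  unfolding skew_on_def
proof (intro allI impI conjI)
  fix zs assume rearranged: "mset zs = mset xs"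
  show "\<phi> zs \<in> carrier F" using assms(2) by auto
  have "zs \<in> tuples n r" "length zs = r"
    using mset_eq_length[OF rearranged] mset_eq_setD[OF rearranged] assms(3)
    by (simp_all add: tuples_def)
  then show "\<phi> (zs[i := zs ! j, j := zs ! i]) = \<epsilon> \<otimes> \<phi> zs" if "i < j \<and> j < length zs" for i j
    using assms(1) that by (simp add: alternating_def)
qed

lemma skew_on_tract_sign: "skew_on (tract_sign F) (mset_set {1..n})"
  unfolding skew_on_def
proof (intro allI impI conjI)
  fix zs :: "nat list" assume "mset zs = mset_set {1..n}"
  then have arranged: "distinct zs" "set zs = {1..n}" by (simp_all add: mset_eq_mset_set_iff)
  then have "set zs = {1..length zs}" using distinct_card by fastforce
  then show "tract_sign F (zs[i := zs ! j, j := zs ! i]) = \<epsilon> \<otimes> tract_sign F zs"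
    if "i < j \<and> j < length zs" for i j
    using tract_sign_swap[OF arranged(1)] that by blast
qed (rule tract_sign_carrier)

subsection \<open>Grassmann-Pluecker relations\<close>

definition pluecker_term ::
    "(nat list \<Rightarrow> 'a) \<Rightarrow> (nat list \<Rightarrow> 'a) \<Rightarrow> nat list \<Rightarrow> nat list \<Rightarrow> nat \<Rightarrow> 'a" where
  "pluecker_term \<nu> \<mu> ys xs k = \<epsilon> [^] Suc k \<otimes> (\<nu> (remove_nth k ys) \<otimes> \<mu> (ys ! k # xs))"

definition pluecker_sum ::
    "(nat list \<Rightarrow> 'a) \<Rightarrow> (nat list \<Rightarrow> 'a) \<Rightarrow> nat list \<Rightarrow> nat list \<Rightarrow> 'a multiset" where
  "pluecker_sum \<nu> \<mu> ys xs = (\<Sum>k<length ys. formal F (pluecker_term \<nu> \<mu> ys xs k))"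

lemma pluecker_rel_iff:
  "pluecker_rel F n w \<nu> r \<mu> \<longleftrightarrow>
     (1 \<le> r \<longrightarrow>
       (\<forall>ys\<in>tuples n (w + 1). \<forall>xs\<in>tuples n (r - 1). pluecker_sum \<nu> \<mu> ys xs \<in> nullset F))"
proof -
  have "pluecker_sum \<nu> \<mu> ys xs = (\<Sum>k<w + 1. formal F (\<epsilon> [^] Suc k \<otimes>
      (\<nu> (take k ys @ drop (Suc k) ys) \<otimes> \<mu> (ys ! k # xs))))" if "ys \<in> tuples n (w + 1)" for ys xs
    using that by (simp only: pluecker_sum_def pluecker_term_def remove_nth_def tuples_def
        mem_Collect_eq)
  then show ?thesis unfolding pluecker_rel_def by simp
qed

lemma pluecker_term_carrier:
  assumes "range \<nu> \<subseteq> carrier F" "range \<mu> \<subseteq> carrier F"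
  shows "pluecker_term \<nu> \<mu> ys xs k \<in> carrier F"
  unfolding pluecker_term_def using assms by (intro m_closed eps_pow_carrier) auto

lemma pluecker_term_eq_zero:
  assumes "range \<nu> \<subseteq> carrier F" "range \<mu> \<subseteq> carrier F"
    and "\<nu> (remove_nth k ys) = tzero F \<or> \<mu> (ys ! k # xs) = tzero F"
  shows "pluecker_term \<nu> \<mu> ys xs k = tzero F"
proof -
  have "\<nu> (remove_nth k ys) \<otimes> \<mu> (ys ! k # xs) = tzero F"
    using assms by (auto simp: tzero_absorb tzero_absorb' image_subset_iff)
  then show ?thesis unfolding pluecker_term_def by (simp only: tzero_absorb' eps_pow_carrier)
qed

lemma pluecker_term_repeated_entry:
  assumes range_\<nu>: "range \<nu> \<subseteq> carrier F" and range_\<mu>: "range \<mu> \<subseteq> carrier F"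
    and skew: "skew_on \<nu> (mset (us @ a # ws @ vs))"
    and ys_split: "ys = us @ a # ws @ a # vs"
  shows "pluecker_term \<nu> \<mu> ys xs (length (us @ a # ws)) = \<epsilon> \<otimes> pluecker_term \<nu> \<mu> ys xs (length us)"
proof -
  let ?v = "\<nu> (us @ a # ws @ vs) \<otimes> \<mu> (a # xs)"
  have v_closed: "?v \<in> carrier F" using range_\<nu> range_\<mu> by (simp add: image_subset_iff)
  have "pluecker_term \<nu> \<mu> ys xs (length (us @ a # ws)) = \<epsilon> [^] Suc (length (us @ a # ws)) \<otimes> ?v"
    using remove_nth_append_Cons[of "us @ a # ws" a vs]
    by (simp add: pluecker_term_def ys_split nth_append del: nat_pow_Suc)
  also have "\<epsilon> [^] Suc (length (us @ a # ws)) = \<epsilon> \<otimes> (\<epsilon> [^] Suc (length us) \<otimes> \<epsilon> [^] length ws)"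
    using eps_carrier by (simp add: eps_pow_parity eps_eps)
  also have "\<dots> \<otimes> ?v = \<epsilon> \<otimes> (\<epsilon> [^] Suc (length us) \<otimes> (\<epsilon> [^] length ws \<otimes> ?v))"
    by (simp only: m_assoc m_closed eps_carrier eps_pow_carrier v_closed)
  also have "\<epsilon> [^] Suc (length us) \<otimes> (\<epsilon> [^] length ws \<otimes> ?v) = pluecker_term \<nu> \<mu> ys xs (length us)"
    using skew_on_move_entry[OF skew refl] range_\<nu> range_\<mu> eps_carrier
    by (simp add: pluecker_term_def ys_split remove_nth_append_Cons m_assoc image_subset_iff)
  finally show ?thesis .
qed

lemma pluecker_sum_not_distinct:
  assumes alternating: "alternating F n w \<nu>"
    and range_\<nu>: "range \<nu> \<subseteq> carrier F" and range_\<mu>: "range \<mu> \<subseteq> carrier F"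
    and ys: "ys \<in> tuples n (w + 1)" "\<not> distinct ys"
  shows "pluecker_sum \<nu> \<mu> ys xs \<in> nullset F"
proof -
  let ?t = "pluecker_term \<nu> \<mu> ys xs"
  obtain us a ws vs where split: "ys = us @ a # ws @ a # vs"
    using not_distinct_decomp[OF ys(2)] by auto
  let ?i = "length us" and ?j = "length (us @ a # ws)"
  have repeated: "?i < ?j" "?j < length ys" "ys ! ?i = ys ! ?j" by (simp_all add: split nth_append)
  have removed: "remove_nth k ys \<in> tuples n w" if "k < length ys" for k
    using ys(1) length_remove_nth[OF that] set_remove_nth_subset[of k ys]
    by (auto simp: tuples_def)
  have other_zero: "?t k = tzero F" if other: "k < length ys" "k \<noteq> ?i" "k \<noteq> ?j" for k
  proof -
    have "\<not> distinct (remove_nth k ys)"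
      using distinct_remove_nth_imp[OF _ other(1) repeated] other by blast
    then have "\<nu> (remove_nth k ys) = tzero F"
      using alternating removed[OF other(1)] unfolding alternating_def by blast
    then show ?thesis using pluecker_term_eq_zero[OF range_\<nu> range_\<mu>] by blast
  qed
  have "pluecker_sum \<nu> \<mu> ys xs = (\<Sum>k\<in>{?i, ?j}. formal F (?t k))"
    unfolding pluecker_sum_def using repeated other_zero
    by (intro sum.mono_neutral_right) (auto simp: formal_zero)
  also have "\<dots> = formal F (?t ?i) + formal F (?t ?j)" using repeated by simp
  also have "?t ?j = \<epsilon> \<otimes> ?t ?i"
    using skew_on_alternating[OF alternating range_\<nu> removed[OF repeated(2)]]
      remove_nth_append_Cons[of "us @ a # ws" a vs]
    by (intro pluecker_term_repeated_entry[OF range_\<nu> range_\<mu> _ split]) (simp add: split)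
  also have "formal F (?t ?i) + formal F (\<epsilon> \<otimes> ?t ?i) \<in> nullset F"
    by (rule formal_add_eps_mult_null[OF pluecker_term_carrier[OF range_\<nu> range_\<mu>]])
  finally show ?thesis .
qed

subsection \<open>Grassmann-Pluecker functions and their classes\<close>

lemma gp_function_range: "gp_function F n r \<phi> \<Longrightarrow> range \<phi> \<subseteq> carrier F"
  using gp_function_carrier by blast

lemma gp_function_eq_zero:
  "gp_function F n r \<phi> \<Longrightarrow> xs \<notin> tuples n r \<or> \<not> distinct xs \<Longrightarrow> \<phi> xs = tzero F"
  unfolding gp_function_def alternating_def by blast

lemma gp_function_support:
  assumes "gp_function F n r \<phi>"
  obtains xs where "xs \<in> tuples n r" "distinct xs" "\<phi> xs \<noteq> tzero F"
  using assms that unfolding gp_function_def alternating_def by blast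

lemma gp_function_rank_le: "gp_function F n r \<phi> \<Longrightarrow> r \<le> n"
  using gp_function_support distinct_tuple_length_le by metis

lemma gp_class_scale_subset:
  assumes c_unit: "c \<in> tract_units F" and range_\<phi>: "range \<phi> \<subseteq> carrier F"
  shows "gp_class F (\<lambda>xs. c \<otimes> \<phi> xs) \<subseteq> gp_class F \<phi>"
proof
  fix \<psi> assume "\<psi> \<in> gp_class F (\<lambda>xs. c \<otimes> \<phi> xs)"
  then obtain d where d_unit: "d \<in> tract_units F" "\<psi> = (\<lambda>xs. d \<otimes> (c \<otimes> \<phi> xs))"
    unfolding gp_class_def by blast
  have "\<psi> = (\<lambda>xs. (d \<otimes> c) \<otimes> \<phi> xs)"
    using d_unit c_unit range_\<phi> by (simp add: m_assoc unit_carrier image_subset_iff)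
  then show "\<psi> \<in> gp_class F \<phi>" unfolding gp_class_def using unit_mult[OF d_unit(1) c_unit] by blast
qed

lemma gp_class_scale:
  assumes c_unit: "c \<in> tract_units F" and range_\<phi>: "range \<phi> \<subseteq> carrier F"
  shows "gp_class F (\<lambda>xs. c \<otimes> \<phi> xs) = gp_class F \<phi>"
proof
  obtain b where b_inverse: "b \<in> tract_units F" "b \<otimes> c = \<one>" using unit_inv[OF c_unit] by metis
  have range_scaled: "range (\<lambda>xs. c \<otimes> \<phi> xs) \<subseteq> carrier F"
    using unit_carrier[OF c_unit] range_\<phi> by auto
  have "(\<lambda>xs. b \<otimes> (c \<otimes> \<phi> xs)) = \<phi>"
    using b_inverse c_unit range_\<phi> by (simp add: unit_carrier image_subset_iff flip: m_assoc)
  then show "gp_class F \<phi> \<subseteq> gp_class F (\<lambda>xs. c \<otimes> \<phi> xs)"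
    using gp_class_scale_subset[OF b_inverse(1) range_scaled] by simp
qed (rule gp_class_scale_subset[OF assms])

lemma self_in_gp_class:
  assumes "range \<phi> \<subseteq> carrier F"
  shows "\<phi> \<in> gp_class F \<phi>"
proof -
  have "\<phi> = (\<lambda>xs. \<one> \<otimes> \<phi> xs)" using assms by (simp add: image_subset_iff)
  then show ?thesis using one_unit unfolding gp_class_def by blast
qed

lemma tract_matroid_gp_class: "gp_function F n r \<phi> \<Longrightarrow> tract_matroid F n (gp_class F \<phi>)"
  unfolding tract_matroid_def matroid_of_rank_def by blast

lemma rk_gp_class: "gp_function F n r \<phi> \<Longrightarrow> rk F n (gp_class F \<phi>) = r"
  by (intro rk_eq) (auto simp: matroid_of_rank_def)

lemma tract_matroid_representative:
  assumes "tract_matroid F n M"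
  obtains \<phi> where "gp_function F n (rk F n M) \<phi>" "M = gp_class F \<phi>"
  using assms rk_gp_class unfolding tract_matroid_def matroid_of_rank_def by blast

lemma flag_matroid_iff_sorted_wrt:
  "flag_matroid F n Ms \<longleftrightarrow>
     (\<forall>M\<in>set Ms. tract_matroid F n M) \<and> sorted_wrt (\<lambda>M N. tract_quotient F n N M) Ms"
  unfolding flag_matroid_def sorted_wrt_iff_nth_less by blast

end

subsection \<open>Duality\<close>

locale involutive_tract = tract F for F :: "('a, 'b) tract_scheme" (structure) +
  fixes \<tau> :: "'a \<Rightarrow> 'a"
  assumes involution: "tract_involution F \<tau>"
begin

lemma \<tau>_hom: "\<tau> \<in> hom F F"
  and \<tau>_one: "\<tau> \<one> = \<one>"
  and \<tau>_zero: "\<tau> (tzero F) = tzero F"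
  and \<tau>_null: "A \<in> nullset F \<Longrightarrow> image_mset \<tau> A \<in> nullset F"
  and \<tau>_\<tau>: "x \<in> carrier F \<Longrightarrow> \<tau> (\<tau> x) = x"
  using involution by (auto simp: tract_involution_def tract_morphism_def)

lemma \<tau>_carrier: "x \<in> carrier F \<Longrightarrow> \<tau> x \<in> carrier F"
  using \<tau>_hom hom_in_carrier by metis

lemma \<tau>_mult: "x \<in> carrier F \<Longrightarrow> y \<in> carrier F \<Longrightarrow> \<tau> (x \<otimes> y) = \<tau> x \<otimes> \<tau> y"
  using \<tau>_hom hom_mult by metis

lemma \<tau>_eq_zero_iff: "x \<in> carrier F \<Longrightarrow> \<tau> x = tzero F \<longleftrightarrow> x = tzero F"
  using \<tau>_\<tau> \<tau>_zero by metis

lemma \<tau>_unit: "x \<in> tract_units F \<Longrightarrow> \<tau> x \<in> tract_units F"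
  using \<tau>_carrier \<tau>_eq_zero_iff by (simp add: tract_units_def)

lemma \<tau>_eps_pow: "\<tau> (\<epsilon> [^] (k::nat)) = \<epsilon> [^] k"
  by (simp add: eps_pow_parity \<tau>_one involution_eps[OF involution])

lemma \<tau>_sign: "\<tau> (tract_sign F zs) = tract_sign F zs"
  by (simp add: tract_sign_def \<tau>_one involution_eps[OF involution])

lemma formal_\<tau>: "x \<in> carrier F \<Longrightarrow> formal F (\<tau> x) = image_mset \<tau> (formal F x)"
  by (simp add: formal_def \<tau>_eq_zero_iff)

lemma dual_fun_range: "range \<phi> \<subseteq> carrier F \<Longrightarrow> range (dual_fun F \<tau> n r \<phi>) \<subseteq> carrier F"
  by (auto simp: dual_fun_def Let_def tract_sign_carrier \<tau>_carrier tzero_closed image_subset_iff)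

lemma dual_fun_scale:
  assumes "c \<in> carrier F" "range \<phi> \<subseteq> carrier F"
  shows "dual_fun F \<tau> n r (\<lambda>xs. c \<otimes> \<phi> xs) = (\<lambda>xs. \<tau> c \<otimes> dual_fun F \<tau> n r \<phi> xs)"
  using assms
  by (auto simp: dual_fun_def Let_def \<tau>_mult \<tau>_carrier tract_sign_carrier m_lcomm tzero_absorb'
      image_subset_iff)

lemma dual_fun_not_distinct: "\<not> distinct xs \<Longrightarrow> dual_fun F \<tau> n r \<phi> xs = tzero F"
  by (simp add: dual_fun_def)

lemma dual_fun_alternating:
  assumes range_\<phi>: "range \<phi> \<subseteq> carrier F"
  shows "alternating F n (n - r) (dual_fun F \<tau> n r \<phi>)"
  unfolding alternating_def
proof (intro ballI conjI allI impI)
  fix xs i j assume xs: "xs \<in> tuples n (n - r)" and i_less_j: "i < j \<and> j < n - r"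
  let ?xs = "xs[i := xs ! j, j := xs ! i]"
  let ?zs = "sorted_list_of_set ({1..n} - set xs)"
  have xs_bounds: "length xs = n - r" "set xs \<subseteq> {1..n}" using xs by (auto simp: tuples_def)
  have swapped: "set ?xs = set xs" "distinct ?xs \<longleftrightarrow> distinct xs" "?xs \<in> tuples n (n - r)"
    using i_less_j xs_bounds by (auto simp: tuples_def)
  show "dual_fun F \<tau> n r \<phi> ?xs = \<epsilon> \<otimes> dual_fun F \<tau> n r \<phi> xs"
  proof (cases "distinct xs")
    case True
    have "mset_set {1..n} = mset xs + mset ?zs"
      using mset_append_complement[OF _ True xs_bounds(2)] by simp
    then have "skew_on (\<lambda>xs. tract_sign F (xs @ ?zs)) (mset xs)"
      using skew_on_tract_sign[of n] skew_on_append[of "tract_sign F" "mset xs" ?zs] by simp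
    from skew_on_swap[OF this refl] have "tract_sign F (?xs @ ?zs) = \<epsilon> \<otimes> tract_sign F (xs @ ?zs)"
      using i_less_j xs_bounds(1) by simp
    moreover have "\<tau> (\<phi> ?zs) \<in> carrier F" using range_\<phi> by (auto intro: \<tau>_carrier)
    ultimately show ?thesis
      using True xs swapped eps_carrier
      by (simp add: dual_fun_def Let_def m_assoc tract_sign_carrier)
  next
    case False
    then show ?thesis using swapped tzero_absorb'[OF eps_carrier]
      by (simp add: dual_fun_not_distinct)
  qed
qed (rule dual_fun_not_distinct)

lemma dual_fun_complement:
  assumes "gp_function F n r \<phi>" "mset (xs @ ys) = mset_set {1..n}" "length ys = r"
  shows "dual_fun F \<tau> n r \<phi> xs = tract_sign F (xs @ ys) \<otimes> \<tau> (\<phi> ys)"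
  using assms(2) by (intro dual_fun_eq[OF involution assms(1) _ _ assms(3)])
    (simp_all only: mset_eq_mset_set_iff finite_atLeastAtMost)

lemma dual_fun_remove_nth:
  assumes gp_\<phi>: "gp_function F n r \<phi>" and arrangement: "mset (ys @ zs) = mset_set {1..n}"
    and length_zs: "Suc (length zs) = r" and k_less: "k < length ys"
  shows "dual_fun F \<tau> n r \<phi> (remove_nth k ys)
    = \<epsilon> [^] (length ys - Suc k) \<otimes> tract_sign F (ys @ zs) \<otimes> \<tau> (\<phi> (ys ! k # zs))"
proof -
  let ?us = "take k ys" and ?a = "ys ! k" and ?vs = "drop (Suc k) ys"
  have split: "ys @ zs = ?us @ ?a # ?vs @ zs" using id_take_nth_drop[OF k_less] by simp
  have "dual_fun F \<tau> n r \<phi> (?us @ ?vs) = tract_sign F ((?us @ ?vs) @ ?a # zs) \<otimes> \<tau> (\<phi> (?a # zs))"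
    using arrangement[unfolded split] length_zs by (intro dual_fun_complement[OF gp_\<phi>]) simp_all
  also have "tract_sign F ((?us @ ?vs) @ ?a # zs) = \<epsilon> [^] length ?vs \<otimes> tract_sign F (ys @ zs)"
    using skew_on_move_entry[OF skew_on_tract_sign arrangement[unfolded split]] by (simp add: split)
  finally show ?thesis by (simp add: remove_nth_def)
qed

lemma dual_fun_Cons_nth:
  assumes gp_\<phi>: "gp_function F n r \<phi>" and arrangement: "mset (xs @ zs) = mset_set {1..n}"
    and length_zs: "length zs = Suc r" and l_less: "l < length zs"
  shows "dual_fun F \<tau> n r \<phi> (zs ! l # xs)
    = \<epsilon> [^] (length xs + l) \<otimes> tract_sign F (xs @ zs) \<otimes> \<tau> (\<phi> (remove_nth l zs))"
proof -
  let ?us = "take l zs" and ?a = "zs ! l" and ?vs = "drop (Suc l) zs"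
  let ?e = "\<epsilon> [^] (length xs + l)" and ?s = "tract_sign F ((?a # xs) @ ?us @ ?vs)"
  have split: "xs @ zs = xs @ ?us @ ?a # ?vs" using id_take_nth_drop[OF l_less] by simp
  have moved: "mset ((?a # xs) @ ?us @ ?vs) = mset_set {1..n}"
    using arrangement[unfolded split] by simp
  have "tract_sign F (xs @ zs) = ?e \<otimes> ?s"
    unfolding split
    using skew_on_move_entry[OF skew_on_tract_sign[of n], of "[]" ?a "xs @ ?us" ?vs] moved l_less
    by simp
  then have "?e \<otimes> tract_sign F (xs @ zs) = ?s"
    by (simp add: eps_pow_parity eps_eps eps_carrier tract_sign_carrier flip: m_assoc)
  moreover have "dual_fun F \<tau> n r \<phi> (?a # xs) = ?s \<otimes> \<tau> (\<phi> (?us @ ?vs))"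
    using length_zs l_less by (intro dual_fun_complement[OF gp_\<phi> moved]) simp
  ultimately show ?thesis by (simp add: remove_nth_def)
qed

lemma pluecker_term_dual:
  assumes gp_\<nu>: "gp_function F n w \<nu>" and gp_\<mu>: "gp_function F n r \<mu>"
    and ys_xs': "mset (ys @ xs') = mset_set {1..n}" "Suc (length xs') = r"
    and xs_ys': "mset (xs @ ys') = mset_set {1..n}" "length ys' = Suc w"
    and k_less: "k < length ys" and l_less: "l < length ys'" and same_entry: "ys ! k = ys' ! l"
  shows "pluecker_term (dual_fun F \<tau> n r \<mu>) (dual_fun F \<tau> n w \<nu>) ys xs k
    = \<epsilon> [^] Suc (length ys + length xs) \<otimes> (tract_sign F (ys @ xs') \<otimes> tract_sign F (xs @ ys'))
      \<otimes> \<tau> (pluecker_term \<nu> \<mu> ys' xs' l)"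
proof -
  let ?s = "tract_sign F (ys @ xs') \<otimes> tract_sign F (xs @ ys')"
  let ?v = "\<nu> (remove_nth l ys')" and ?u = "\<mu> (ys' ! l # xs')"
  note closed = gp_function_carrier[OF gp_\<nu>] gp_function_carrier[OF gp_\<mu>]
    m_closed \<tau>_carrier tract_sign_carrier eps_pow_carrier
  have "pluecker_term (dual_fun F \<tau> n r \<mu>) (dual_fun F \<tau> n w \<nu>) ys xs k
      = \<epsilon> [^] Suc k \<otimes> \<epsilon> [^] (length ys - Suc k) \<otimes> \<epsilon> [^] (length xs + l) \<otimes> ?s \<otimes> (\<tau> ?v \<otimes> \<tau> ?u)"
    unfolding pluecker_term_def dual_fun_remove_nth[OF gp_\<mu> ys_xs' k_less] same_entry
      dual_fun_Cons_nth[OF gp_\<nu> xs_ys' l_less]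
    by (simp only: m_ac closed)
  also have "\<epsilon> [^] Suc k \<otimes> \<epsilon> [^] (length ys - Suc k) \<otimes> \<epsilon> [^] (length xs + l)
      = \<epsilon> [^] Suc (length ys + length xs) \<otimes> \<epsilon> [^] Suc l"
    unfolding nat_pow_mult[OF eps_carrier] using k_less by (intro eps_pow_eq_if_same_parity) auto
  also have "\<dots> \<otimes> ?s \<otimes> (\<tau> ?v \<otimes> \<tau> ?u)
      = \<epsilon> [^] Suc (length ys + length xs) \<otimes> ?s \<otimes> \<tau> (pluecker_term \<nu> \<mu> ys' xs' l)"
    unfolding pluecker_term_def by (simp only: m_ac closed \<tau>_mult \<tau>_eps_pow)
  finally show ?thesis .
qed

lemma pluecker_sum_dual:
  assumes gp_\<nu>: "gp_function F n w \<nu>" and gp_\<mu>: "gp_function F n r \<mu>"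
    and ys_xs': "mset (ys @ xs') = mset_set {1..n}" "Suc (length xs') = r"
    and xs_ys': "mset (xs @ ys') = mset_set {1..n}" "length ys' = Suc w"
  obtains c where "c \<in> tract_units F"
    and "pluecker_sum (dual_fun F \<tau> n r \<mu>) (dual_fun F \<tau> n w \<nu>) ys xs
      = image_mset (\<lambda>a. c \<otimes> a) (image_mset \<tau> (pluecker_sum \<nu> \<mu> ys' xs'))"
proof
  let ?c = "\<epsilon> [^] Suc (length ys + length xs) \<otimes> (tract_sign F (ys @ xs') \<otimes> tract_sign F (xs @ ys'))"
  let ?t = "pluecker_term (dual_fun F \<tau> n r \<mu>) (dual_fun F \<tau> n w \<nu>) ys xs"
  let ?t' = "pluecker_term \<nu> \<mu> ys' xs'"
  note range = gp_function_range[OF gp_\<nu>] gp_function_range[OF gp_\<mu>]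
  have distinct: "distinct ys" "distinct ys'"
    and partition: "set ys \<union> set xs' = {1..n}" "set xs \<union> set ys' = {1..n}"
    using ys_xs'(1) xs_ys'(1) by (simp_all only: mset_eq_mset_set_iff finite_atLeastAtMost) auto
  show c_unit: "?c \<in> tract_units F" by (intro unit_mult eps_pow_unit tract_sign_unit)
  have "pluecker_sum (dual_fun F \<tau> n r \<mu>) (dual_fun F \<tau> n w \<nu>) ys xs
      = (\<Sum>l<length ys'. formal F (?c \<otimes> \<tau> (?t' l)))"
    unfolding pluecker_sum_def
  proof (rule sum_nth_eq_if_matching[OF distinct])
    fix k l assume "k < length ys" "l < length ys'" "ys ! k = ys' ! l"
    then show "formal F (?t k) = formal F (?c \<otimes> \<tau> (?t' l))"
      using pluecker_term_dual[OF assms] by simp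
  next
    fix k assume "k < length ys" "ys ! k \<notin> set ys'"
    then have "ys ! k \<in> set xs" using partition nth_mem by blast
    then have "?t k = tzero F"
      by (intro pluecker_term_eq_zero dual_fun_range range) (simp add: dual_fun_not_distinct)
    then show "formal F (?t k) = 0" by (simp add: formal_zero)
  next
    fix l assume "l < length ys'" "ys' ! l \<notin> set ys"
    then have "ys' ! l \<in> set xs'" using partition nth_mem by blast
    then have "?t' l = tzero F"
      by (intro pluecker_term_eq_zero range) (simp add: gp_function_eq_zero[OF gp_\<mu>])
    then show "formal F (?c \<otimes> \<tau> (?t' l)) = 0"
      using unit_carrier[OF c_unit] by (simp add: \<tau>_zero tzero_absorb' formal_zero del: nat_pow_Suc)
  qed
  also have "\<dots> = image_mset (\<lambda>a. ?c \<otimes> a) (image_mset \<tau> (pluecker_sum \<nu> \<mu> ys' xs'))"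
    unfolding pluecker_sum_def image_mset_sum
    by (simp only: formal_scale[OF c_unit] formal_\<tau> \<tau>_carrier pluecker_term_carrier range)
  finally show "pluecker_sum (dual_fun F \<tau> n r \<mu>) (dual_fun F \<tau> n w \<nu>) ys xs = \<dots>" .
qed

lemma pluecker_rel_dual:
  assumes gp_\<nu>: "gp_function F n w \<nu>" and gp_\<mu>: "gp_function F n r \<mu>"
    and rel: "pluecker_rel F n w \<nu> r \<mu>"
  shows "pluecker_rel F n (n - r) (dual_fun F \<tau> n r \<mu>) (n - w) (dual_fun F \<tau> n w \<nu>)"
  unfolding pluecker_rel_iff
proof (intro impI ballI)
  fix ys xs assume "1 \<le> n - w"
    and ys: "ys \<in> tuples n (n - r + 1)" and xs: "xs \<in> tuples n (n - w - 1)"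
  note range = dual_fun_range[OF gp_function_range[OF gp_\<mu>]]
    dual_fun_range[OF gp_function_range[OF gp_\<nu>]]
  consider (repeated_ys) "\<not> distinct ys" | (repeated_xs) "\<not> distinct xs"
    | (distinct) "distinct ys" "distinct xs" by blast
  then show "pluecker_sum (dual_fun F \<tau> n r \<mu>) (dual_fun F \<tau> n w \<nu>) ys xs \<in> nullset F"
  proof cases
    case repeated_ys
    then show ?thesis
      using pluecker_sum_not_distinct[OF dual_fun_alternating range ys] gp_function_range[OF gp_\<mu>]
      by blast
  next
    case repeated_xs
    then have "pluecker_term (dual_fun F \<tau> n r \<mu>) (dual_fun F \<tau> n w \<nu>) ys xs k = tzero F" for k
      by (intro pluecker_term_eq_zero range) (simp add: dual_fun_not_distinct)
    then show ?thesis using zero_in_nullset by (simp add: pluecker_sum_def formal_zero)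
  next
    case distinct
    obtain xs' where xs': "xs' \<in> tuples n (n - (n - r + 1))" "mset (ys @ xs') = mset_set {1..n}"
      using complement_tuple[OF ys distinct(1)] .
    obtain ys' where ys': "ys' \<in> tuples n (n - (n - w - 1))" "mset (xs @ ys') = mset_set {1..n}"
      using complement_tuple[OF xs distinct(2)] .
    have ranks: "n - (n - r + 1) = r - 1" "1 \<le> r" "n - (n - w - 1) = w + 1"
      using distinct_tuple_length_le[OF ys distinct(1)] gp_function_rank_le[OF gp_\<mu>] \<open>1 \<le> n - w\<close> by auto
    have lengths: "Suc (length xs') = r" "length ys' = Suc w"
      using xs'(1) ys'(1) ranks by (auto simp: tuples_def)
    obtain c where "c \<in> tract_units F"
      "pluecker_sum (dual_fun F \<tau> n r \<mu>) (dual_fun F \<tau> n w \<nu>) ys xs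
        = image_mset (\<lambda>a. c \<otimes> a) (image_mset \<tau> (pluecker_sum \<nu> \<mu> ys' xs'))"
      using pluecker_sum_dual[OF gp_\<nu> gp_\<mu> xs'(2) lengths(1) ys'(2) lengths(2)] .
    moreover have "pluecker_sum \<nu> \<mu> ys' xs' \<in> nullset F"
      using rel xs'(1) ys'(1) ranks by (simp add: pluecker_rel_iff)
    ultimately show ?thesis using nullset_stable \<tau>_null by simp
  qed
qed

lemma gp_function_dual_fun:
  assumes gp_\<phi>: "gp_function F n r \<phi>"
  shows "gp_function F n (n - r) (dual_fun F \<tau> n r \<phi>)"
proof -
  obtain ys where ys: "ys \<in> tuples n r" "distinct ys" "\<phi> ys \<noteq> tzero F"
    using gp_function_support[OF gp_\<phi>] .
  obtain xs where xs: "xs \<in> tuples n (n - r)" "mset (ys @ xs) = mset_set {1..n}"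
    using complement_tuple[OF ys(1,2)] .
  have "dual_fun F \<tau> n r \<phi> xs = tract_sign F (xs @ ys) \<otimes> \<tau> (\<phi> ys)"
    using xs(2) ys(1) by (intro dual_fun_complement[OF gp_\<phi>]) (auto simp: tuples_def add.commute)
  then have "dual_fun F \<tau> n r \<phi> xs \<noteq> tzero F"
    using ys(3) gp_function_carrier[OF gp_\<phi>]
    by (simp add: unit_mult_eq_zero_iff tract_sign_unit \<tau>_carrier \<tau>_eq_zero_iff)
  moreover have "pluecker_rel F n (n - r) (dual_fun F \<tau> n r \<phi>) (n - r) (dual_fun F \<tau> n r \<phi>)"
    using pluecker_rel_dual[OF gp_\<phi> gp_\<phi>] gp_\<phi> by (simp add: gp_function_def)
  moreover have "dual_fun F \<tau> n r \<phi> zs = tzero F" if "zs \<notin> tuples n (n - r)" for zs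
    using that by (simp add: dual_fun_def)
  moreover have "dual_fun F \<tau> n r \<phi> zs \<in> carrier F" for zs
    using dual_fun_range[OF gp_function_range[OF gp_\<phi>]] by blast
  ultimately show ?thesis
    using xs(1) dual_fun_alternating[OF gp_function_range[OF gp_\<phi>]]
    unfolding gp_function_def by blast
qed

lemma dual_fun_dual_fun:
  assumes gp_\<phi>: "gp_function F n r \<phi>"
  shows "dual_fun F \<tau> n (n - r) (dual_fun F \<tau> n r \<phi>) = (\<lambda>xs. \<epsilon> [^] (r * (n - r)) \<otimes> \<phi> xs)"
proof
  fix xs
  show "dual_fun F \<tau> n (n - r) (dual_fun F \<tau> n r \<phi>) xs = \<epsilon> [^] (r * (n - r)) \<otimes> \<phi> xs"
  proof (cases "xs \<in> tuples n r \<and> distinct xs")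
    case False
    then show ?thesis
      using gp_function_eq_zero[OF gp_\<phi>, of xs] gp_function_rank_le[OF gp_\<phi>]
        tzero_absorb'[OF eps_pow_carrier]
      by (auto simp: dual_fun_def)
  next
    case True
    then obtain ys where "ys \<in> tuples n (n - r)" and arrangement: "mset (xs @ ys) = mset_set {1..n}"
      using complement_tuple by blast
    then have lengths: "length xs = r" "length ys = n - r" using True by (auto simp: tuples_def)
    let ?s = "tract_sign F (xs @ ys)" and ?e = "\<epsilon> [^] (r * (n - r))"
    have "dual_fun F \<tau> n (n - r) (dual_fun F \<tau> n r \<phi>) xs = ?s \<otimes> \<tau> (dual_fun F \<tau> n r \<phi> ys)"
      using arrangement lengths by (intro dual_fun_complement[OF gp_function_dual_fun[OF gp_\<phi>]])
    also have "dual_fun F \<tau> n r \<phi> ys = tract_sign F (ys @ xs) \<otimes> \<tau> (\<phi> xs)"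
      using arrangement lengths by (intro dual_fun_complement[OF gp_\<phi>]) (simp_all add: add.commute)
    also have "tract_sign F (ys @ xs) = ?e \<otimes> ?s"
      using skew_on_exchange_blocks[OF skew_on_tract_sign arrangement] lengths by simp
    also have "?s \<otimes> \<tau> (?e \<otimes> ?s \<otimes> \<tau> (\<phi> xs)) = (?s \<otimes> ?s) \<otimes> (?e \<otimes> \<phi> xs)"
      using gp_function_carrier[OF gp_\<phi>] tract_sign_carrier eps_pow_carrier
      by (simp add: m_ac \<tau>_mult \<tau>_sign \<tau>_eps_pow \<tau>_\<tau> \<tau>_carrier)
    finally show ?thesis using gp_function_carrier[OF gp_\<phi>] eps_pow_carrier
      by (simp add: tract_sign_square)
  qed
qed

lemma dual_gp_class:
  assumes gp_\<phi>: "gp_function F n r \<phi>"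
  shows "dual F \<tau> n (gp_class F \<phi>) = gp_class F (dual_fun F \<tau> n r \<phi>)"
proof -
  note range = gp_function_range[OF gp_\<phi>]
  have "gp_class F (dual_fun F \<tau> n r \<psi>) = gp_class F (dual_fun F \<tau> n r \<phi>)"
    if \<psi>_class: "\<psi> \<in> gp_class F \<phi>" for \<psi>
  proof -
    obtain c where c_scale: "c \<in> tract_units F" "\<psi> = (\<lambda>xs. c \<otimes> \<phi> xs)"
      using \<psi>_class unfolding gp_class_def by blast
    then show ?thesis
      using dual_fun_scale[OF unit_carrier[OF c_scale(1)] range]
        gp_class_scale[OF \<tau>_unit[OF c_scale(1)] dual_fun_range[OF range]] by simp
  qed
  then show ?thesis
    using self_in_gp_class[OF range] unfolding dual_def rk_gp_class[OF gp_\<phi>] by blast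
qed

lemma
  assumes "tract_matroid F n M"
  shows tract_matroid_dual: "tract_matroid F n (dual F \<tau> n M)"
    and rk_dual: "rk F n (dual F \<tau> n M) = n - rk F n M"
proof -
  obtain \<phi> where gp_\<phi>: "gp_function F n (rk F n M) \<phi>" "M = gp_class F \<phi>"
    using tract_matroid_representative[OF assms] .
  then have "dual F \<tau> n M = gp_class F (dual_fun F \<tau> n (rk F n M) \<phi>)"
    using dual_gp_class by metis
  then show "tract_matroid F n (dual F \<tau> n M)" "rk F n (dual F \<tau> n M) = n - rk F n M"
    using tract_matroid_gp_class rk_gp_class gp_function_dual_fun[OF gp_\<phi>(1)] by auto
qed

lemma dual_dual:
  assumes "tract_matroid F n M"
  shows "dual F \<tau> n (dual F \<tau> n M) = M"
proof -
  obtain r \<phi> where gp_\<phi>: "gp_function F n r \<phi>" "M = gp_class F \<phi>"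
    using tract_matroid_representative[OF assms] .
  then show ?thesis
    using gp_class_scale[OF eps_pow_unit gp_function_range[OF gp_\<phi>(1)]]
    by (simp add: dual_gp_class[OF gp_\<phi>(1)] dual_gp_class[OF gp_function_dual_fun[OF gp_\<phi>(1)]]
        dual_fun_dual_fun[OF gp_\<phi>(1)])
qed

lemma dual_quotient:
  assumes "tract_matroid F n N" "tract_matroid F n M" "tract_quotient F n N M"
  shows "tract_quotient F n (dual F \<tau> n M) (dual F \<tau> n N)"
proof -
  obtain w \<nu> where gp_\<nu>: "gp_function F n w \<nu>" "N = gp_class F \<nu>"
    using tract_matroid_representative[OF assms(1)] .
  obtain r \<mu> where gp_\<mu>: "gp_function F n r \<mu>" "M = gp_class F \<mu>"
    using tract_matroid_representative[OF assms(2)] .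
  have "pluecker_rel F n w \<nu> r \<mu>"
    using assms(3) tract_quotient_iff[OF gp_\<nu>(1) gp_\<mu>(1)] gp_\<nu>(2) gp_\<mu>(2) by simp
  from pluecker_rel_dual[OF gp_\<nu>(1) gp_\<mu>(1) this] show ?thesis
    using tract_quotient_iff[OF gp_function_dual_fun[OF gp_\<mu>(1)] gp_function_dual_fun[OF gp_\<nu>(1)]]
    by (simp add: gp_\<nu>(2) gp_\<mu>(2) dual_gp_class[OF gp_\<nu>(1)] dual_gp_class[OF gp_\<mu>(1)])
qed

lemma flag_matroid_dual:
  assumes "flag_matroid F n Ms"
  shows "flag_matroid F n (rev (map (dual F \<tau> n) Ms))"
proof -
  have Ms: "\<forall>M\<in>set Ms. tract_matroid F n M" "sorted_wrt (\<lambda>M N. tract_quotient F n N M) Ms"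
    using assms by (simp_all add: flag_matroid_iff_sorted_wrt)
  then have "sorted_wrt (\<lambda>M N. tract_quotient F n (dual F \<tau> n M) (dual F \<tau> n N)) Ms"
    using dual_quotient by (intro sorted_wrt_mono_rel[OF _ Ms(2)]) blast
  then show ?thesis
    using Ms(1) tract_matroid_dual
    by (auto simp: flag_matroid_iff_sorted_wrt sorted_wrt_rev sorted_wrt_map)
qed

lemma flag_matroids_of_rank_dual:
  assumes "Ms \<in> flag_matroids_of_rank F n rs"
  shows "rev (map (dual F \<tau> n) Ms) \<in> flag_matroids_of_rank F n (rev (map (\<lambda>r. n - r) rs))"
proof -
  have Ms: "flag_matroid F n Ms" "map (rk F n) Ms = rs"
    using assms by (auto simp: flag_matroids_of_rank_def)
  then have "map (rk F n) (map (dual F \<tau> n) Ms) = map (\<lambda>r. n - r) rs"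
    using rk_dual by (auto simp: flag_matroid_def)
  then show ?thesis
    using flag_matroid_dual[OF Ms(1)] by (simp add: flag_matroids_of_rank_def flip: rev_map)
qed

lemma flag_dual_dual:
  assumes "Ms \<in> flag_matroids_of_rank F n rs"
  shows "rev (map (dual F \<tau> n) (rev (map (dual F \<tau> n) Ms))) = Ms"
  using assms dual_dual
  by (auto simp: flag_matroids_of_rank_def flag_matroid_def rev_map intro!: map_idI)

end

theorem theorem2p12:
  fixes F :: "('a, 'b) tract_scheme" and \<tau> :: "'a \<Rightarrow> 'a" and n :: nat and rs :: "nat list"
  assumes "tract F" and "tract_involution F \<tau>"
    and "sorted rs" and "\<forall>r\<in>set rs. r \<le> n"
  shows "bij_betw (\<lambda>Ms. rev (map (dual F \<tau> n) Ms))
           (flag_matroids_of_rank F n rs)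
           (flag_matroids_of_rank F n (rev (map (\<lambda>r. n - r) rs)))"
proof -
  interpret tract F by fact
  interpret involutive_tract F \<tau> by unfold_locales fact
  have "rev (map (\<lambda>r. n - r) (rev (map (\<lambda>r. n - r) rs))) = rs"
    using assms(4) by (auto simp: rev_map intro!: map_idI)
  then have "rev (map (dual F \<tau> n) Ms) \<in> flag_matroids_of_rank F n rs"
    if "Ms \<in> flag_matroids_of_rank F n (rev (map (\<lambda>r. n - r) rs))" for Ms
    using flag_matroids_of_rank_dual[OF that] by simp
  then show ?thesis
    using flag_matroids_of_rank_dual flag_dual_dual
    by (intro bij_betw_byWitness[where f' = "\<lambda>Ms. rev (map (dual F \<tau> n) Ms)"]) blast+
qed

end
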